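(* Let $n,k,\ell$ be integers with $1\le k\le n/2$ and $1\le \ell\le n/2$. Then, with $c=2$ colours and $\boldsymbol{\ell}=(\ell,n-\ell)$, $$\begin{aligned}D(n,k,(\ell,n-\ell))\le{}&\ \ell\left[\left(1-\frac{k}{n}\right)\log\left(1-\frac{k}{n}\right)+\frac{k}{n}-\frac{k}{2n(n-1)}\right]+\frac{k\ell}{(n-1)(n-\ell)(n-k)}\\&-\frac{k(k-1)}{2n(n-1)}\,\ell(\ell-1)\log\left(\frac{\ell}{\ell-1}\right)\\&-\frac{k(k-1)(k-2)}{6n(n-1)(n-2)}\,\ell(\ell-1)(\ell-2)\log\left(\frac{(\ell-1)^2}{\ell(\ell-2)}\right).\end{aligned}$$ Here, when $\ell=1$ the last two terms (those on the second and third lines) are interpreted as $0$, and when $\ell=2$ the last term (third line) is interpreted as $0$.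
   Context: For a vector $\boldsymbol{u}=(u_1,\ldots,u_c)$ of nonnegative integers with $u_1+\cdots+u_c=v$, write $\binom{v}{\boldsymbol{u}}=v!/\prod_{i=1}^c u_i!$. The multivariate hypergeometric p.m.f. (sampling $k$ balls without replacement from an urn of $n$ balls with $\ell_i$ balls of colour $i$, $\boldsymbol{\ell}=(\ell_1,\ldots,\ell_c)$, $\sum_i \ell_i=n$) is $$H(n,k,\boldsymbol{\ell};\boldsymbol{s})=\frac{\prod_{i=1}^c\binom{\ell_i}{s_i}}{\binom{n}{k}}$$ for integer vectors $\boldsymbol{s}=(s_1,\ldots,s_c)$ with $0\le s_i\le \ell_i$ and $s_1+\cdots+s_c=k$ (and $0$ for other $\boldsymbol{s}$). The multinomial p.m.f. (sampling with replacement) is $$B(n,k,\boldsymbol{\ell};\boldsymbol{s})=\binom{k}{\boldsymbol{s}}\prod_{i=1}^c\left(\frac{\ell_i}{n}\right)^{s_i}$$ for integer vectors $\boldsymbol{s}$ with $s_i\ge 0$ and $s_1+\cdots+s_c=k$. The relative entropy is $$D(n,k,\boldsymbol{\ell})=\sum_{\boldsymbol{s}}H(n,k,\boldsymbol{\ell};\boldsymbol{s})\log\left(\frac{H(n,k,\boldsymbol{\ell};\boldsymbol{s})}{B(n,k,\boldsymbol{\ell};\boldsymbol{s})}\right),$$ with $\log$ the natural logarithm and $0\log 0=0$. *)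

theory Defs
  imports Complex_Main
begin

text \<open>A vector with \<open>c\<close> nonnegative integer entries, one for each colour, is a \<open>nat list\<close> of
  length \<open>c\<close>.  Throughout, \<open>n\<close> is the total number of balls, so that \<open>ls\<close> is meant to satisfy
  \<open>sum_list ls = n\<close>.\<close>

definition count_vectors :: "nat \<Rightarrow> nat \<Rightarrow> nat list set" where
  "count_vectors c k = {s. length s = c \<and> sum_list s = k}"

lemma finite_count_vectors: "finite (count_vectors c k)"
proof (rule finite_subset)
  show "count_vectors c k \<subseteq> {s. set s \<subseteq> {..k} \<and> length s = c}"
    by (auto simp: count_vectors_def dest: member_le_sum_list)
  show "finite {s. set s \<subseteq> {..k} \<and> length s = c}"
    by (rule finite_lists_length_eq) simp
qed

definition multinomial :: "nat \<Rightarrow> nat list \<Rightarrow> real" where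
  "multinomial v u = fact v / (\<Prod>i<length u. fact (u ! i))"

text \<open>Sampling without replacement.\<close>

definition mv_hypergeometric :: "nat \<Rightarrow> nat \<Rightarrow> nat list \<Rightarrow> nat list \<Rightarrow> real" where
  "mv_hypergeometric n k ls s =
     (if s \<in> count_vectors (length ls) k \<and> (\<forall>i<length ls. s ! i \<le> ls ! i)
      then (\<Prod>i<length ls. real ((ls ! i) choose (s ! i))) / real (n choose k)
      else 0)"

text \<open>Sampling with replacement.\<close>

definition multinomial_prob :: "nat \<Rightarrow> nat \<Rightarrow> nat list \<Rightarrow> nat list \<Rightarrow> real" where
  "multinomial_prob n k ls s =
     (if s \<in> count_vectors (length ls) k
      then multinomial k s * (\<Prod>i<length ls. (real (ls ! i) / real n) ^ (s ! i))
      else 0)"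

text \<open>The sum ranges over the support constraints of the multinomial distribution, outside of which
  both mass functions vanish.  A summand with zero hypergeometric mass is \<open>0\<close> because of its first
  factor, which is the convention \<open>0 log 0 = 0\<close>.  If \<open>sum_list ls = n\<close>, the multinomial mass is
  positive wherever the hypergeometric mass is, so no division by zero matters.\<close>

definition rel_entropy :: "nat \<Rightarrow> nat \<Rightarrow> nat list \<Rightarrow> real" where
  "rel_entropy n k ls =
     (\<Sum>s\<in>count_vectors (length ls) k.
        mv_hypergeometric n k ls s *
        ln (mv_hypergeometric n k ls s / multinomial_prob n k ls s))"

end

theory Submission
  imports Defs
begin

text \<open>Write \<open>g\<^sub>m(t) = log ((m)\<^sub>t / m\<^sup>t)\<close>, with \<open>(m)\<^sub>t\<close> the falling factorial, and let \<open>S\<close> be the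
  hypergeometric number of balls of the first colour. Then
  \<open>D = E g\<^sub>l(S) + E g\<^bsub>n-l\<^esub>(k - S) - g\<^sub>n(k)\<close>. Newton's forward expansion of \<open>g\<^sub>l\<close> at \<open>0\<close> has nonpositive
  coefficients, and cutting it off after the cubic term gives the last two terms of the bound.

  For the rest, recolour the \<open>l\<close> balls one at a time. If \<open>T\<^sub>m\<close> counts the sampled balls when
  \<open>m\<close> balls have the second colour, then with \<open>Y = 1 - T\<^sub>m / m\<close>
  \<open>E g\<^bsub>m-1\<^esub>(T\<^bsub>m-1\<^esub>) - E g\<^sub>m(T\<^sub>m) = E (Y log Y) + (k / n) (m - 1) log (m / (m - 1))\<close>.
  With \<open>q = 1 - k / n\<close> and \<open>Y = q (1 + u)\<close>, the bound \<open>log (1 + u) \<le> u - u\<^sup>2/2 + u\<^sup>3/3\<close> leaves the second,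
  third and fourth central moments of \<open>T\<^sub>m\<close>. The third is nonpositive because \<open>k \<le> n/2 \<le> m\<close>,
  and the fourth is small enough to be absorbed by the term \<open>k l / ((n - 1) (n - l) (n - k))\<close>,
  whose increments in \<open>l\<close> are \<open>k n / ((n - 1) (n - k) m (m - 1))\<close> with \<open>m = n - l\<close>.\<close>

section \<open>Expectations under the hypergeometric distribution\<close>

definition hyp_mean :: "nat \<Rightarrow> nat \<Rightarrow> nat \<Rightarrow> (nat \<Rightarrow> real) \<Rightarrow> real" where
  "hyp_mean n k m f =
     (\<Sum>t\<le>k. real (m choose t) * real ((n - m) choose (k - t)) * f t) / real (n choose k)"

lemma hyp_mean_add: "hyp_mean n k m (\<lambda>t. f t + g t) = hyp_mean n k m f + hyp_mean n k m g"
  by (simp add: hyp_mean_def distrib_left sum.distrib add_divide_distrib)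

lemma hyp_mean_cmult: "hyp_mean n k m (\<lambda>t. c * f t) = c * hyp_mean n k m f"
  by (simp add: hyp_mean_def sum_distrib_left mult.left_commute)

lemma hyp_mean_diff: "hyp_mean n k m (\<lambda>t. f t - g t) = hyp_mean n k m f - hyp_mean n k m g"
  using hyp_mean_add[of n k m f "\<lambda>t. (-1) * g t"] hyp_mean_cmult[of n k m "-1" g] by simp

text \<open>Off the support one of the two binomial weights is zero, so \<open>f\<close> and
  \<open>g\<close> may take any values there. This matters because \<open>log_fall\<close> is junk
  outside its range.\<close>

lemma hyp_mean_mono:
  assumes "\<And>t. t \<le> k \<Longrightarrow> t \<le> m \<Longrightarrow> k - t \<le> n - m \<Longrightarrow> f t \<le> g t"
  shows "hyp_mean n k m f \<le> hyp_mean n k m g"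
  unfolding hyp_mean_def
proof (intro divide_right_mono sum_mono)
  fix t assume "t \<in> {..k}"
  then show "real (m choose t) * real ((n - m) choose (k - t)) * f t
      \<le> real (m choose t) * real ((n - m) choose (k - t)) * g t"
    by (cases "t \<le> m \<and> k - t \<le> n - m")
      (use assms[of t] in \<open>simp add: mult_left_mono\<close>, auto simp: not_le binomial_eq_0)
qed simp

lemma hyp_mean_cong:
  assumes "\<And>t. t \<le> k \<Longrightarrow> t \<le> m \<Longrightarrow> k - t \<le> n - m \<Longrightarrow> f t = g t"
  shows "hyp_mean n k m f = hyp_mean n k m g"
  by (intro antisym hyp_mean_mono) (simp_all add: assms)

text \<open>Trinomial revision trades \<open>t choose j\<close> for a constant factor
  \<open>m choose j\<close>, and Vandermonde sums the remaining weights. Binomial moments fit the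
  Newton expansion of \<open>log_fall\<close>; \<open>j = 0\<close> and \<open>j = 1\<close> give
  normalisation and mean.\<close>

lemma hyp_mean_choose:
  assumes "k \<le> n" "m \<le> n"
  shows "hyp_mean n k m (\<lambda>t. real (t choose j))
    = real (m choose j) * real (k choose j) / real (n choose j)"
proof (cases "j \<le> k")
  case False
  then have "hyp_mean n k m (\<lambda>t. real (t choose j)) = hyp_mean n k m (\<lambda>t. 0)"
    by (intro hyp_mean_cong) simp
  then show ?thesis unfolding hyp_mean_def using False by (simp add: not_le binomial_eq_0)
next
  case True
  have "(\<Sum>t\<le>k. (m choose t) * ((n - m) choose (k - t)) * (t choose j))
      = (\<Sum>t\<in>{j..k}. (m choose j) * (((m - j) choose (t - j)) * ((n - m) choose (k - t))))"
  proof (rule sum.mono_neutral_cong_right)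
    fix t assume t: "t \<in> {j..k}"
    show "(m choose t) * ((n - m) choose (k - t)) * (t choose j)
        = (m choose j) * (((m - j) choose (t - j)) * ((n - m) choose (k - t)))"
    proof (cases "t \<le> m")
      case True
      then show ?thesis using t choose_mult[of j t m] by (simp add: mult_ac)
    next
      case False
      then have "j \<le> m \<Longrightarrow> m - j < t - j" using t by auto
      then show ?thesis using False by (cases "j \<le> m") (simp_all add: not_le binomial_eq_0)
    qed
  qed auto
  also have "\<dots> = (m choose j) * (\<Sum>i\<le>k - j. ((m - j) choose i) * ((n - m) choose (k - j - i)))"
    unfolding sum_distrib_left
    by (rule sum.reindex_bij_witness[of _ "\<lambda>i. i + j" "\<lambda>t. t - j"]) (use True in auto)
  also have "\<dots> = (m choose j) * ((n - j) choose (k - j))"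
    using vandermonde[of "m - j" "n - m" "k - j"] assms by (cases "j \<le> m") simp_all
  finally have *: "(\<Sum>t\<le>k. real (m choose t) * real ((n - m) choose (k - t)) * real (t choose j))
      = real (m choose j) * real ((n - j) choose (k - j))"
    unfolding of_nat_mult[symmetric] of_nat_sum[symmetric] by simp
  have "real (n choose k) * real (k choose j) = real (n choose j) * real ((n - j) choose (k - j))"
    using choose_mult[of j k n] True assms by (metis of_nat_mult)
  moreover have "real (n choose k) \<noteq> 0" "real (n choose j) \<noteq> 0" using True assms by auto
  ultimately show ?thesis unfolding hyp_mean_def * by (simp add: field_simps)
qed

lemma hyp_mean_const:
  assumes "k \<le> n" "m \<le> n"
  shows "hyp_mean n k m (\<lambda>_. c) = c"
  using hyp_mean_choose[OF assms, of 0] hyp_mean_cmult[of n k m c "\<lambda>_. 1"] by simp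

lemma hyp_mean_id:
  assumes "k \<le> n" "m \<le> n"
  shows "hyp_mean n k m real = real k * real m / real n"
  using hyp_mean_choose[OF assms, of 1] by (simp add: mult.commute)

lemma choose_mult_diff:
  "real (m choose t) * (real m - real t) = real (m choose Suc t) * real (Suc t)"
proof (cases "t \<le> m")
  case True
  have "(m choose t) * (m - t) = (m choose Suc t) * Suc t"
    by (metis binomial_absorb_comp binomial_absorption mult.commute)
  then show ?thesis using True by (metis of_nat_diff of_nat_mult)
qed (simp add: not_le binomial_eq_0)

text \<open>Detailed balance of the hypergeometric weights. Both quadratic factors have the same
  leading term, so that this determines the central moments recursively.\<close>

lemma hyp_mean_balance:
  assumes "k \<le> n" "m \<le> n"
  shows "hyp_mean n k m (\<lambda>t. (real m - real t) * (real k - real t) * f (real t))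
    = hyp_mean n k m (\<lambda>t. real t * (real n - real k - real m + real t) * f (real t - 1))"
proof -
  define w where "w t = real (m choose t) * real ((n - m) choose (k - t))" for t
  have w: "w t * ((real m - real t) * (real k - real t))
      = w (Suc t) * (real (Suc t) * (real n - real k - real m + real (Suc t)))" if "t < k" for t
  proof -
    have "Suc (k - Suc t) = k - t" using that by simp
    then have "real ((n - m) choose (k - Suc t)) * (real (n - m) - real (k - Suc t))
        = real ((n - m) choose (k - t)) * real (k - t)"
      using choose_mult_diff[of "n - m" "k - Suc t"] by metis
    then have 1: "real ((n - m) choose (k - t)) * (real k - real t)
        = real ((n - m) choose (k - Suc t)) * (real n - real k - real m + real (Suc t))"
      using that assms by (simp add: of_nat_diff algebra_simps)
    have "w t * ((real m - real t) * (real k - real t))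
        = (real (m choose t) * (real m - real t))
          * (real ((n - m) choose (k - t)) * (real k - real t))"
      by (simp add: w_def)
    also have "\<dots> = w (Suc t) * (real (Suc t) * (real n - real k - real m + real (Suc t)))"
      unfolding 1 choose_mult_diff w_def by simp
    finally show ?thesis .
  qed
  \<comment> \<open>The term \<open>t = k\<close> vanishes through \<open>real k - real t\<close>;
    after the shift, the new term \<open>t = 0\<close> vanishes through
    \<open>real t\<close>.\<close>
  have "(\<Sum>t\<le>k. w t * ((real m - real t) * (real k - real t) * f (real t)))
      = (\<Sum>t<k. w t * ((real m - real t) * (real k - real t)) * f (real t))"
    by (simp add: lessThan_Suc_atMost[symmetric] mult.assoc)
  also have "\<dots> = (\<Sum>t<k. w (Suc t) * (real (Suc t) * (real n - real k - real m + real (Suc t)))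
        * f (real (Suc t) - 1))"
    by (intro sum.cong) (simp_all only: w lessThan_iff, simp)
  also have "\<dots> = (\<Sum>t\<le>k. w t * (real t * (real n - real k - real m + real t) * f (real t - 1)))"
    by (simp add: sum.lessThan_Suc_shift lessThan_Suc_atMost[symmetric] mult.assoc
        del: sum.lessThan_Suc)
  finally show ?thesis by (simp add: hyp_mean_def w_def)
qed

text \<open>Recolour a uniformly chosen one of the \<open>m\<close> balls: given that
  \<open>t\<close> of them are in the sample, it is a sampled one with probability
  \<open>t / m\<close>. For \<open>t = 0\<close> the truncated \<open>t - 1\<close> carries weight
  zero.\<close>

lemma hyp_mean_remove:
  assumes "0 < m" "m \<le> n"
  shows "hyp_mean n k (m - 1) f
    = hyp_mean n k m (\<lambda>t. real t / real m * f (t - 1) + (1 - real t / real m) * f t)"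
proof -
  obtain a where a: "m = Suc a" using assms by (cases m) auto
  define N where "N = n - m"
  have N: "n - (m - 1) = Suc N" using assms by (simp add: N_def)
  have 1: "real (m choose t) * (1 - real t / real m) = real (a choose t)" for t
  proof -
    have "real (m choose t) * (real m - real t) = real m * real (a choose t)"
      unfolding choose_mult_diff a of_nat_mult[symmetric] using Suc_times_binomial_eq[of a t]
      by (simp only: mult_ac)
    then show ?thesis using a by (simp add: field_simps)
  qed
  have 2: "real (m choose Suc t) * (real (Suc t) / real m) = real (a choose t)" for t
  proof -
    have "real (m choose Suc t) * real (Suc t) = real (a choose t) * real m"
      unfolding a of_nat_mult[symmetric] using Suc_times_binomial_eq[of a t]
      by (simp only: mult_ac)
    then show ?thesis using assms by simp
  qed
  have "(\<Sum>t\<le>k. real (m choose t) * real (N choose (k - t))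
         * (real t / real m * f (t - 1) + (1 - real t / real m) * f t))
     = (\<Sum>t\<le>k. (real (m choose t) * (real t / real m)) * real (N choose (k - t)) * f (t - 1))
     + (\<Sum>t\<le>k. (real (m choose t) * (1 - real t / real m)) * real (N choose (k - t)) * f t)"
    unfolding sum.distrib[symmetric] by (intro sum.cong) (simp_all add: algebra_simps)
  also have "(\<Sum>t\<le>k. (real (m choose t) * (real t / real m)) * real (N choose (k - t)) * f (t - 1))
     = (\<Sum>t<k. real (a choose t) * real (N choose (k - Suc t)) * f t)"
    unfolding lessThan_Suc_atMost[symmetric] sum.lessThan_Suc_shift 2 by simp
  also have "(\<Sum>t\<le>k. (real (m choose t) * (1 - real t / real m)) * real (N choose (k - t)) * f t)
     = (\<Sum>t<k. real (a choose t) * real (N choose (k - t)) * f t) + real (a choose k) * f k"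
    unfolding 1 lessThan_Suc_atMost[symmetric] by simp
  \<comment> \<open>Pascal's rule merges the two sums; \<open>t = k\<close> stays apart, since there
    \<open>k - t\<close> is not a successor.\<close>
  also have "(\<Sum>t<k. real (a choose t) * real (N choose (k - Suc t)) * f t) + \<dots>
     = (\<Sum>t<k. real (a choose t) * real (Suc N choose (k - t)) * f t) + real (a choose k) * f k"
  proof -
    have "real (Suc N choose (k - t)) = real (N choose (k - Suc t)) + real (N choose (k - t))"
      if "t < k" for t
    proof -
      have "k - t = Suc (k - Suc t)" using that by simp
      then show ?thesis by (simp only: binomial_Suc_Suc of_nat_add)
    qed
    then have "(\<Sum>t<k. real (a choose t) * real (Suc N choose (k - t)) * f t)
        = (\<Sum>t<k. real (a choose t) * real (N choose (k - Suc t)) * f t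
            + real (a choose t) * real (N choose (k - t)) * f t)"
      by (intro sum.cong) (simp_all only: lessThan_iff distrib_left distrib_right)
    then show ?thesis by (simp only: sum.distrib add.assoc)
  qed
  also have "\<dots> = (\<Sum>t\<le>k. real (a choose t) * real (Suc N choose (k - t)) * f t)"
    unfolding lessThan_Suc_atMost[symmetric] by simp
  finally show ?thesis unfolding hyp_mean_def N N_def[symmetric] using a by simp
qed


lemma hyp_mean_reflect:
  assumes "m \<le> n"
  shows "hyp_mean n k m (\<lambda>t. f (k - t)) = hyp_mean n k (n - m) f"
proof -
  have "(\<Sum>t\<le>k. real (m choose t) * real ((n - m) choose (k - t)) * f (k - t))
      = (\<Sum>t\<le>k. real ((n - m) choose t) * real (m choose (k - t)) * f t)"
    by (rule sum.reindex_bij_witness[of _ "\<lambda>t. k - t" "\<lambda>t. k - t"]) auto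
  then show ?thesis using assms by (simp add: hyp_mean_def)
qed

lemma hyp_mean_full:
  assumes "k \<le> n"
  shows "hyp_mean n k n f = f k"
proof -
  have "hyp_mean n k n f = hyp_mean n k n (\<lambda>_. f k)" by (intro hyp_mean_cong) simp
  then show ?thesis using hyp_mean_const[of k n n] assms by simp
qed

section \<open>Central moments of the hypergeometric distribution\<close>

lemma hyp_mean_poly4:
  assumes "k \<le> n" "m \<le> n"
  shows "hyp_mean n k m (\<lambda>t. a0 + a1 * w t + a2 * w t ^ 2 + a3 * w t ^ 3 + a4 * w t ^ 4)
    = a0 + a1 * hyp_mean n k m w + a2 * hyp_mean n k m (\<lambda>t. w t ^ 2)
      + a3 * hyp_mean n k m (\<lambda>t. w t ^ 3) + a4 * hyp_mean n k m (\<lambda>t. w t ^ 4)"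
  by (simp add: hyp_mean_add hyp_mean_cmult hyp_mean_const[OF assms])

text \<open>In the centred variable \<open>w\<close> the quadratics of
  \<open>hyp_mean_balance\<close> become \<open>w^2 + (s - n) w + c\<close> and
  \<open>w^2 + s w + c\<close>. Inserting \<open>x\<close>, \<open>x ^ 2\<close> and
  \<open>x ^ 3\<close> for \<open>f\<close> cancels the leading powers and yields one linear
  relation for each new moment.\<close>

lemma hyp_mean_central_moments:
  fixes n k m :: nat and f :: "nat \<Rightarrow> real"
  assumes "k \<le> n" "m \<le> n" "0 < n"
  defines "w \<equiv> \<lambda>t. real t - real k * real m / real n"
  defines "c \<equiv> real k * real m * (real n - real k) * (real n - real m) / (real n)\<^sup>2"
    and "s \<equiv> (real k * real m + (real n - real k) * (real n - real m)) / real n"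
  shows "hyp_mean n k m w = 0"
    and "(real n - 1) * hyp_mean n k m (\<lambda>t. w t ^ 2) = c"
    and "(real n - 2) * hyp_mean n k m (\<lambda>t. w t ^ 3)
      = (2 * s - real n) * hyp_mean n k m (\<lambda>t. w t ^ 2)"
    and "(real n - 3) * hyp_mean n k m (\<lambda>t. w t ^ 4)
      = 3 * (s - 1) * hyp_mean n k m (\<lambda>t. w t ^ 3)
        + (3 * c - 3 * s + real n) * hyp_mean n k m (\<lambda>t. w t ^ 2)"
proof -
  define \<mu> where "\<mu> = real k * real m / real n"
  define e where "e j = hyp_mean n k m (\<lambda>t. w t ^ j)" for j
  have A: "(real m - real t) * (real k - real t) = w t ^ 2 + (s - real n) * w t + c" for t
    using assms by (simp add: w_def c_def s_def field_simps power2_eq_square)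
  have B: "real t * (real n - real k - real m + real t) = w t ^ 2 + s * w t + c" for t
    using assms by (simp add: w_def c_def s_def field_simps power2_eq_square)
  have bal: "hyp_mean n k m (\<lambda>t. (w t ^ 2 + (s - real n) * w t + c) * f (w t)
      - (w t ^ 2 + s * w t + c) * f (w t - 1)) = 0" for f
    using hyp_mean_balance[OF assms(1,2), of "\<lambda>x. f (x - \<mu>)"]
    by (simp add: A B hyp_mean_diff) (simp add: w_def \<mu>_def algebra_simps)
  show e1: "hyp_mean n k m w = 0"
    unfolding w_def
    by (simp add: hyp_mean_diff hyp_mean_id[OF assms(1,2)] hyp_mean_const[OF assms(1,2)])
  \<comment> \<open>The coefficient \<open>a1\<close> disappears because the first moment is
    zero.\<close>
  have poly: "a0 + a2 * e 2 + a3 * e 3 + a4 * e 4 = 0"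
    if "\<And>t. (w t ^ 2 + (s - real n) * w t + c) * f (w t) - (w t ^ 2 + s * w t + c) * f (w t - 1)
      = a0 + a1 * w t + a2 * w t ^ 2 + a3 * w t ^ 3 + a4 * w t ^ 4" for f a0 a1 a2 a3 a4
    using bal[of f] unfolding that hyp_mean_poly4[OF assms(1,2)] e1 by (simp add: e_def)
  note powers = algebra_simps power2_eq_square power3_eq_cube power4_eq_xxxx
  have "c + (1 - real n) * e 2 + 0 * e 3 + 0 * e 4 = 0"
    by (rule poly[of "\<lambda>x. x" _ s]) (simp add: powers)
  then show e2: "(real n - 1) * hyp_mean n k m (\<lambda>t. w t ^ 2) = c"
    by (simp add: e_def algebra_simps)
  have "- c + (2 * s - 1) * e 2 + (2 - real n) * e 3 + 0 * e 4 = 0"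
    by (rule poly[of "\<lambda>x. x ^ 2" _ "2 * c - s"]) (simp add: powers)
  then show "(real n - 2) * hyp_mean n k m (\<lambda>t. w t ^ 3)
      = (2 * s - real n) * hyp_mean n k m (\<lambda>t. w t ^ 2)"
    by (simp add: e_def algebra_simps flip: e2)
  have "c + (3 * c - 3 * s + 1) * e 2 + (3 * s - 3) * e 3 + (3 - real n) * e 4 = 0"
    by (rule poly[of "\<lambda>x. x ^ 3" _ "s - 3 * c"]) (simp add: powers)
  \<comment> \<open>Rewriting the bare constant as a multiple of \<open>e 2\<close> turns the
    \<open>1\<close> in its coefficient into \<open>real n\<close>.\<close>
  moreover have "c = (real n - 1) * e 2" by (simp add: e_def e2)
  ultimately show "(real n - 3) * hyp_mean n k m (\<lambda>t. w t ^ 4)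
      = 3 * (s - 1) * hyp_mean n k m (\<lambda>t. w t ^ 3)
        + (3 * c - 3 * s + real n) * hyp_mean n k m (\<lambda>t. w t ^ 2)"
    unfolding e_def[symmetric] by (smt (verit) left_diff_distrib mult.assoc distrib_right)
qed

section \<open>Logarithms of normalised falling factorials\<close>

text \<open>Beware: \<open>log_fall m t\<close> is the junk value \<open>ln 0 = 0\<close> for \<open>t > m\<close>.\<close>

definition log_fall :: "nat \<Rightarrow> nat \<Rightarrow> real" where
  "log_fall m t = ln (real (m choose t) * fact t / real m ^ t)"

lemma log_fall_0 [simp]: "log_fall m 0 = 0"
  by (simp add: log_fall_def)

lemma log_fall_Suc:
  assumes "t < m"
  shows "log_fall m (Suc t) = log_fall m t + ln (1 - real t / real m)"
proof -
  have "real (m choose Suc t) * fact (Suc t) / real m ^ Suc t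
      = (real (m choose Suc t) * real (Suc t)) * fact t / real m ^ Suc t"
    by simp
  also have "\<dots> = (real (m choose t) * fact t / real m ^ t) * (1 - real t / real m)"
    unfolding choose_mult_diff[symmetric] using assms by (simp add: field_simps)
  finally show ?thesis using assms unfolding log_fall_def by (simp only:) (subst ln_mult_pos, auto)
qed

text \<open>Removing a sampled ball divides the falling factorial by \<open>m\<close>, so only the
  change of base from \<open>m\<close> to \<open>m - 1\<close> in the remaining \<open>t - 1\<close>
  powers is left.\<close>

lemma log_fall_remove_hit:
  assumes "0 < t" "t \<le> m" "2 \<le> m"
  shows "log_fall (m - 1) (t - 1) = log_fall m t + (real t - 1) * ln (real m / (real m - 1))"
proof -
  obtain a b where ab: "m = Suc a" "t = Suc b" "b \<le> a" "0 < a"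
    using assms by (cases m; cases t) auto
  have "real (Suc a) * real (a choose b) = real (Suc b) * real (Suc a choose Suc b)"
    using Suc_times_binomial_eq[of a b] by (metis mult.commute of_nat_mult)
  then have "real (a choose b) * fact b / real a ^ b
      = (real (m choose t) * fact t / real m ^ t) * (real m / real a) ^ b"
    using ab by (simp add: field_simps del: of_nat_Suc binomial_Suc_Suc)
  then have "log_fall a b = ln (real (m choose t) * fact t / real m ^ t * (real m / real a) ^ b)"
    unfolding log_fall_def by simp
  also have "\<dots> = log_fall m t + ln ((real m / real a) ^ b)"
    unfolding log_fall_def
    by (rule ln_mult_pos) (use ab in \<open>simp_all del: of_nat_Suc fact_Suc binomial_Suc_Suc\<close>)
  finally show ?thesis using ab by (simp add: ln_realpow)
qed

text \<open>Removing an unsampled ball multiplies the falling factorial by \<open>1 - t / m\<close>.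
  At \<open>t = m\<close> this factor is zero, hence the strict inequality.\<close>

lemma log_fall_remove_miss:
  assumes "t < m" "2 \<le> m"
  shows "log_fall (m - 1) t
    = log_fall m t + ln (1 - real t / real m) + real t * ln (real m / (real m - 1))"
proof -
  obtain a where a: "m = Suc a" "0 < a" using assms by (cases m) auto
  have "real (m choose t) * (real m - real t) = real m * real (a choose t)"
    unfolding choose_mult_diff a of_nat_mult[symmetric] using Suc_times_binomial_eq[of a t]
    by (simp only: mult_ac)
  moreover define y where "y = 1 - real t / real m"
  moreover have "real m - real t = real m * y" using a by (simp add: y_def right_diff_distrib)
  ultimately have "real (a choose t) = real (m choose t) * y" using a by simp
  then have "real (a choose t) * fact t / real a ^ t
      = (real (m choose t) * fact t / real m ^ t) * (y * (real m / real a) ^ t)"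
    using a by (simp add: power_divide del: of_nat_Suc binomial_Suc_Suc)
  then have "log_fall a t = ln (real (m choose t) * fact t / real m ^ t
      * ((1 - real t / real m) * (real m / real a) ^ t))"
    unfolding log_fall_def y_def by simp
  also have "\<dots> = log_fall m t + ln ((1 - real t / real m) * (real m / real a) ^ t)"
    unfolding log_fall_def by (rule ln_mult_pos) (use a assms in simp_all)
  also have "ln ((1 - real t / real m) * (real m / real a) ^ t)
      = ln (1 - real t / real m) + ln ((real m / real a) ^ t)"
    by (rule ln_mult_pos) (use a assms in simp_all)
  finally show ?thesis using a by (simp add: ln_realpow)
qed

text \<open>In Newton's expansion at 0 the differences of orders 0 and 1 vanish, and those of orders
  2 and 3 are \<open>- a\<close> and \<open>- b\<close>. Third differences are largest at 0, so
  bounding each by \<open>- b\<close> and summing three times gives the claim.\<close>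

lemma log_fall_le:
  assumes "1 \<le> l" "s \<le> l"
  defines "a \<equiv> ln (real l / (real l - 1))"
    and "b \<equiv> ln ((real l - 1)\<^sup>2 / (real l * (real l - 2)))"
  shows "log_fall l s \<le> - (real (s choose 2) * a) - real (s choose 3) * b"
proof -
  define d where "d j = ln (1 - real j / real l)" for j
  have dd: "d (Suc j) - d j \<le> - a - real j * b" if "Suc j < l" for j
    using that
  proof (induction j)
    case 0
    then have "1 - 1 / real l = inverse (real l / (real l - 1))" by (simp add: field_simps)
    then show ?case using 0 by (simp add: d_def a_def ln_inverse del: inverse_divide)
  next
    case (Suc j)
    \<comment> \<open>The third difference is \<open>ln (1 - 1 / z^2)\<close> and \<open>- b\<close>
      is \<open>ln (1 - 1 / x^2)\<close>, so the comparison reduces to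
      \<open>z \<le> x\<close>.\<close>
    define x where "x = real l - 1"
    define z where "z = real l - real j - 1"
    have xz: "1 < z" "z \<le> x" using Suc.prems by (auto simp: x_def z_def)
    have dl: "d i = ln (real l - real i) - ln (real l)" if "i < l" for i
    proof -
      have "1 - real i / real l = (real l - real i) / real l" using that by (simp add: field_simps)
      then show ?thesis using that by (simp add: d_def ln_divide_pos)
    qed
    have dz: "d j = ln (z + 1) - ln (real l)" "d (Suc j) = ln z - ln (real l)"
      "d (Suc (Suc j)) = ln (z - 1) - ln (real l)"
      using Suc.prems by (simp_all add: dl z_def algebra_simps)
    have "(z - 1) * (z + 1) * x\<^sup>2 \<le> z\<^sup>2 * ((x + 1) * (x - 1))"
      using power_mono[of z x 2] xz by (simp add: algebra_simps power2_eq_square)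
    then have "ln ((z - 1) * (z + 1) * x\<^sup>2) \<le> ln (z\<^sup>2 * ((x + 1) * (x - 1)))"
      using xz by (subst ln_le_cancel_iff) auto
    moreover have "b = ln (x\<^sup>2 / ((x + 1) * (x - 1)))" by (simp add: b_def x_def)
    moreover have "- a - real j * b - b = - a - real (Suc j) * b" by (simp add: algebra_simps)
    ultimately show ?case
      using Suc.IH Suc.prems xz unfolding dz
      by (simp add: ln_mult_pos ln_divide_pos ln_realpow)
  qed
  have d: "d j \<le> - (real j * a) - real (j choose 2) * b" if "j < l" for j
    using that
  proof (induction j)
    case (Suc j)
    have "Suc j choose 2 = (j choose 2) + j" by (simp add: numeral_2_eq_2)
    then show ?case using Suc.IH Suc.prems dd[of j] by (simp add: algebra_simps)
  qed (simp add: d_def binomial_eq_0)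
  show ?thesis using \<open>s \<le> l\<close>
  proof (induction s)
    case (Suc s)
    have "Suc s choose 2 = (s choose 2) + s" "Suc s choose 3 = (s choose 3) + (s choose 2)"
      by (simp_all add: numeral_2_eq_2 numeral_3_eq_3)
    then show ?case using Suc.IH Suc.prems d[of s] log_fall_Suc[of s l]
      by (simp add: algebra_simps d_def)
  qed (simp add: binomial_eq_0)
qed

section \<open>Logarithm inequalities\<close>

text \<open>The difference \<open>h\<close> has derivative \<open>x ^ 3 / (1 + x)\<close>, which has
  the sign of \<open>x\<close>, so \<open>h\<close> is minimal at 0.\<close>

lemma ln_add_one_le_cubic:
  fixes u :: real
  assumes "-1 < u"
  shows "ln (1 + u) \<le> u - u\<^sup>2 / 2 + u ^ 3 / 3"
proof -
  define h where "h x = x - x\<^sup>2 / 2 + x ^ 3 / 3 - ln (1 + x)" for x :: real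
  have h: "(h has_real_derivative x ^ 3 / (1 + x)) (at x)" if "-1 < x" for x
    unfolding h_def using that
    by (auto intro!: derivative_eq_intros simp: field_simps power2_eq_square power3_eq_cube)
  have "h 0 \<le> h u"
  proof (cases "0 \<le> u")
    case True
    then show ?thesis
    proof (rule DERIV_nonneg_imp_nondecreasing)
      fix x assume "0 \<le> x" "x \<le> u"
      then show "\<exists>D. (h has_real_derivative D) (at x) \<and> 0 \<le> D"
        using h[of x] by (intro exI[of _ "x ^ 3 / (1 + x)"]) simp
    qed
  next
    case False
    then have "u \<le> 0" by simp
    then show ?thesis
    proof (rule DERIV_nonpos_imp_nonincreasing)
      fix x assume x: "u \<le> x" "x \<le> 0"
      then have "x ^ 3 \<le> 0" by (simp add: power3_eq_cube mult_nonneg_nonpos mult_nonpos_nonpos)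
      then show "\<exists>D. (h has_real_derivative D) (at x) \<and> D \<le> 0"
        using h[of x] x assms by (intro exI[of _ "x ^ 3 / (1 + x)"]) (simp add: divide_nonpos_pos)
    qed
  qed
  then show ?thesis by (simp add: h_def)
qed

text \<open>The difference has nonnegative derivative by \<open>ln (1 - y) \<le> - y\<close>. Taken
  at \<open>1 / m\<close> it bounds \<open>(m - 1) * ln (m / (m - 1))\<close> from above; at
  \<open>1 / n\<close> it serves the case \<open>k = 1\<close>.\<close>

lemma entropy_lower:
  fixes x :: real
  assumes "0 \<le> x" "x < 1"
  shows "x\<^sup>2 / 2 - x \<le> (1 - x) * ln (1 - x)"
proof -
  define h where "h y = (1 - y) * ln (1 - y) + y - 1 / 2 * y\<^sup>2" for y :: real
  have h: "(h has_real_derivative - ln (1 - y) - y) (at y)" if "y < 1" for y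
    unfolding h_def using that by (auto intro!: derivative_eq_intros)
  have "h 0 \<le> h x"
    using assms(1)
  proof (rule DERIV_nonneg_imp_nondecreasing)
    fix y assume "0 \<le> y" "y \<le> x"
    then have "y < 1" using assms by simp
    then show "\<exists>D. (h has_real_derivative D) (at y) \<and> 0 \<le> D"
      using h[of y] ln_le_minus_one[of "1 - y"] by (intro exI[of _ "- ln (1 - y) - y"]) simp
  qed
  then show ?thesis by (simp add: h_def)
qed


section \<open>Moment bounds and a single recolouring step\<close>

text \<open>\<open>n + 2 \<le> 2 * m\<close> says that at least half of the balls keep the second
  colour even after one more is recoloured. The fourth moment bound is shaped so that
  \<open>log_fall_mean_step\<close> turns it into a term of order \<open>1 / m ^ 2\<close>.\<close>

lemma hyp_mean_fourth_moment:
  fixes n k m :: nat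
  assumes "2 \<le> k" "2 * k \<le> n" "m \<le> n" "n + 2 \<le> 2 * m"
  defines "w \<equiv> \<lambda>t. real t - real k * real m / real n"
    and "p \<equiv> real k / real n"
  shows "hyp_mean n k m w = 0"
    and "hyp_mean n k m (\<lambda>t. w t ^ 2)
      = p * (1 - p) * real m * (real n - real m) / (real n - 1)"
    and "hyp_mean n k m (\<lambda>t. w t ^ 3) \<le> 0"
    and "hyp_mean n k m (\<lambda>t. w t ^ 4)
      \<le> 3 / 2 * p * (1 - p)\<^sup>2 * (real m)\<^sup>2 * real n / (real n - 1)"
proof -
  have n: "4 \<le> n" "k \<le> n" "0 < n" using assms by auto
  define c where "c = real k * real m * (real n - real k) * (real n - real m) / (real n)\<^sup>2"
  define s where "s = (real k * real m + (real n - real k) * (real n - real m)) / real n"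
  define d where "d = real n - real m"
  define x where "x = (1 - p) * real m"
  define e where "e j = hyp_mean n k m (\<lambda>t. w t ^ j)" for j
  show "hyp_mean n k m w = 0"
    unfolding w_def by (rule hyp_mean_central_moments(1)[OF n(2) \<open>m \<le> n\<close> n(3)])
  have m2: "(real n - 1) * e 2 = c"
    unfolding e_def w_def c_def by (rule hyp_mean_central_moments(2)[OF n(2) \<open>m \<le> n\<close> n(3)])
  have m3: "(real n - 2) * e 3 = (2 * s - real n) * e 2"
    unfolding e_def w_def s_def by (rule hyp_mean_central_moments(3)[OF n(2) \<open>m \<le> n\<close> n(3)])
  have m4: "(real n - 3) * e 4 = 3 * (s - 1) * e 3 + (3 * c - 3 * s + real n) * e 2"
    unfolding e_def w_def c_def s_def
    by (rule hyp_mean_central_moments(4)[OF n(2) \<open>m \<le> n\<close> n(3)])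
  have c: "c = p * x * d"
    using n by (simp add: c_def p_def x_def d_def field_simps power2_eq_square)
  have p: "0 \<le> p" "p \<le> 1 / 2" using assms(2) n by (simp_all add: p_def field_simps)
  have d: "0 \<le> d" "d \<le> real n / 2 - 1" using assms(3,4) by (simp_all add: d_def)
  have "1 / 2 * real m \<le> x" unfolding x_def using p by (intro mult_right_mono) auto
  then have x: "0 \<le> x" "d \<le> 2 * x" using d assms(4) by (auto simp: d_def)
  have c0: "0 \<le> c" using c p x d by simp
  have e2: "e 2 = c / (real n - 1)" using m2 n by (simp add: field_simps)
  then show "hyp_mean n k m (\<lambda>t. w t ^ 2)
      = p * (1 - p) * real m * (real n - real m) / (real n - 1)"
    by (simp add: e_def c x_def d_def)
  have e20: "0 \<le> e 2" using c0 n by (simp add: e2)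
  \<comment> \<open>This is where both \<open>k \<le> n/2\<close> and \<open>m \<ge> n/2\<close> enter.\<close>
  have "2 * s - real n = (real n - 2 * real k) * (real n - 2 * real m) / real n"
    using n by (simp add: s_def field_simps)
  also have "\<dots> \<le> 0"
    using assms(2,4) by (intro divide_nonpos_nonneg mult_nonneg_nonpos) auto
  finally have "(real n - 2) * e 3 \<le> 0"
    unfolding m3 using e20 by (simp add: mult_nonpos_nonneg)
  then show e3: "hyp_mean n k m (\<lambda>t. w t ^ 3) \<le> 0"
    using n by (simp add: mult_le_0_iff e_def)
  \<comment> \<open>Here \<open>2 \<le> k\<close> enters: \<open>1 \<le> s\<close> makes the third
    moment term nonpositive and lets \<open>- 3 * s\<close> be replaced by
    \<open>- 3\<close>.\<close>
  have "real n * 1 \<le> real k * real m + (real n - real k) * (real n - real m)"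
  proof -
    have "2 * real m \<le> real k * real m" using assms(1) by (intro mult_right_mono) auto
    moreover have "0 \<le> (real n - real k) * (real n - real m)" using n assms(3) by simp
    ultimately show ?thesis using assms(4) by linarith
  qed
  then have s: "1 \<le> s" using n by (simp add: s_def field_simps)
  then have "(real n - 3) * e 4 \<le> (3 * c - 3 * s + real n) * e 2"
    unfolding m4 using e3 by (simp add: e_def mult_nonneg_nonpos)
  also have "\<dots> \<le> (3 * c + (real n - 3)) * e 2"
    using s e20 by (intro mult_right_mono) auto
  also have "\<dots> = (3 * c + (real n - 3)) * d * (p * x / (real n - 1))"
    by (simp add: e2 c)
  \<comment> \<open>The factor \<open>p * x / (n - 1)\<close> is set aside. In the rest,
    \<open>c * d\<close> is bounded through \<open>p \<le> 1 / 2\<close> and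
    \<open>d \<le> n / 2 - 1\<close>, the other term through \<open>d \<le> 2 * x\<close>; what
    remains is \<open>x\<close> times an inequality in \<open>n\<close> alone.\<close>
  also have "\<dots> \<le> (real n - 3) * (3 / 2 * x * real n) * (p * x / (real n - 1))"
  proof (rule mult_right_mono)
    have "d * d \<le> (real n / 2 - 1) * (real n / 2 - 1)" using d by (intro mult_mono) auto
    then have "p * (d * d) \<le> 1 / 2 * ((real n / 2 - 1) * (real n / 2 - 1))"
      using p by (intro mult_mono[of p]) auto
    then have 1: "3 * x * (p * (d * d)) \<le> 3 * x * (1 / 2 * ((real n / 2 - 1) * (real n / 2 - 1)))"
      using x by (intro mult_left_mono) auto
    have 2: "(real n - 3) * d \<le> (real n - 3) * (2 * x)"
      using x n by (intro mult_left_mono) auto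
    \<comment> \<open>The gap between the two sides of the next inequality, written so that
      \<open>4 \<le> n\<close> shows its sign.\<close>
    have "0 \<le> (real n - 4) * (9 * real n - 4) / 8 + 5 / 2" using n by simp
    then have "3 * (1 / 2 * ((real n / 2 - 1) * (real n / 2 - 1))) + 2 * (real n - 3)
        \<le> 3 / 2 * real n * (real n - 3)"
      by (simp add: algebra_simps add_divide_distrib diff_divide_distrib)
    from mult_left_mono[OF this x(1)] 1 2
    show "(3 * c + (real n - 3)) * d \<le> (real n - 3) * (3 / 2 * x * real n)"
      by (simp add: c algebra_simps)
  qed (use p x n in auto)
  finally have "(real n - 3) * e 4
      \<le> (real n - 3) * (3 / 2 * p * (1 - p)\<^sup>2 * (real m)\<^sup>2 * real n / (real n - 1))"
    by (simp add: x_def power2_eq_square mult_ac)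
  then have "e 4 \<le> 3 / 2 * p * (1 - p)\<^sup>2 * (real m)\<^sup>2 * real n / (real n - 1)"
    by (rule mult_left_le_imp_le) (use n in simp)
  then show "hyp_mean n k m (\<lambda>t. w t ^ 4)
      \<le> 3 / 2 * p * (1 - p)\<^sup>2 * (real m)\<^sup>2 * real n / (real n - 1)"
    unfolding e_def .
qed

lemma log_fall_mean_step:
  fixes n k m :: nat
  assumes "2 \<le> k" "2 * k \<le> n" "m \<le> n" "n + 2 \<le> 2 * m"
  shows "hyp_mean n k (m - 1) (log_fall (m - 1)) - hyp_mean n k m (log_fall m)
    \<le> (1 - real k / real n) * ln (1 - real k / real n) + real k / real n
      - real k / (2 * real n * (real n - 1))
      + real k * real n / ((real n - 1) * (real n - real k) * real m * (real m - 1))"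
proof -
  have n: "4 \<le> n" "k \<le> n" "0 < n" "3 \<le> m" using assms by auto
  define N M where "N = real n" and "M = real m"
  have NM: "4 \<le> N" "3 \<le> M" "M \<le> N" using n assms by (auto simp: N_def M_def)
  define p where "p = real k / N"
  define q where "q = 1 - p"
  define L where "L = ln (M / (M - 1))"
  define w where "w t = real t - real k * M / N" for t
  \<comment> \<open>Chosen so that \<open>1 - t / M\<close>, whose mean is \<open>q\<close>, equals
    \<open>q * (1 + u)\<close> with \<open>u = - (v * w t)\<close>.\<close>
  define v where "v = 1 / (M * q)"
  have p: "0 \<le> p" "p \<le> 1 / 2" using assms(2) n by (simp_all add: p_def N_def field_simps)
  have q: "1 / 2 \<le> q" "q \<le> 1" using p by (auto simp: q_def)
  have v: "0 < v" using q NM by (simp add: v_def)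
  have Y: "1 - real t / M = q * (1 - v * w t)" for t
    using NM q by (simp add: q_def[symmetric] v_def w_def field_simps)
      (simp add: q_def p_def algebra_simps)
  have moments: "hyp_mean n k m w = 0"
    "hyp_mean n k m (\<lambda>t. w t ^ 2) = p * q * M * (N - M) / (N - 1)"
    "hyp_mean n k m (\<lambda>t. w t ^ 3) \<le> 0"
    "hyp_mean n k m (\<lambda>t. w t ^ 4) \<le> 3 / 2 * p * q\<^sup>2 * M\<^sup>2 * N / (N - 1)"
    unfolding w_def q_def p_def N_def M_def by (rule hyp_mean_fourth_moment[OF assms])+
  have "hyp_mean n k (m - 1) (log_fall (m - 1)) - hyp_mean n k m (log_fall m)
      = hyp_mean n k m (\<lambda>t. real t / M * log_fall (m - 1) (t - 1)
          + (1 - real t / M) * log_fall (m - 1) t - log_fall m t)"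
    using hyp_mean_remove[of m n k "log_fall (m - 1)"] n assms(3) by (simp add: hyp_mean_diff M_def)
  also have "\<dots> \<le> hyp_mean n k m (\<lambda>t. (1 - 1 / M) * L * real t
      + (q * ln q + (- q * v * (1 + ln q)) * w t
      + (q * v\<^sup>2 / 2) * w t ^ 2 + (q * v ^ 3 / 6) * w t ^ 3 + (q * v ^ 4 / 3) * w t ^ 4))"
  proof (rule hyp_mean_mono)
    fix t assume t: "t \<le> m"
    define y where "y = 1 - real t / M"
    define u where "u = - (v * w t)"
    have y: "y = q * (1 + u)" "0 \<le> y" using t Y[of t] NM by (auto simp: y_def u_def M_def field_simps)
    have "real t / M * log_fall (m - 1) (t - 1) + y * log_fall (m - 1) t - log_fall m t
        = y * ln y + (1 - 1 / M) * L * real t"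
    proof -
      \<comment> \<open>\<open>1 - y\<close> vanishes at \<open>t = 0\<close> and \<open>y\<close>
        at \<open>t = m\<close>, exactly where the removal lemmas do not apply.\<close>
      have 1: "real t / M * log_fall (m - 1) (t - 1) = (1 - y) * (log_fall m t + (real t - 1) * L)"
        using log_fall_remove_hit[of t m] t n by (cases "t = 0") (auto simp: y_def L_def M_def)
      have 2: "y * log_fall (m - 1) t = y * (log_fall m t + ln y + real t * L)"
        using log_fall_remove_miss[of t m] t n NM
        by (cases "t = m") (auto simp: y_def L_def M_def)
      have 3: "(1 - 1 / M) * L * real t = L * real t - L * (1 - y)"
        by (simp add: y_def algebra_simps)
      show ?thesis unfolding 1 2 3 by (simp add: algebra_simps)
    qed
    moreover have "y * ln y \<le> q * ln q + (- q * v * (1 + ln q)) * w t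
      + (q * v\<^sup>2 / 2) * w t ^ 2 + (q * v ^ 3 / 6) * w t ^ 3 + (q * v ^ 4 / 3) * w t ^ 4"
    proof -
      \<comment> \<open>For \<open>y = 0\<close> the argument \<open>1 + u\<close> is zero, outside
        the range of the Taylor bound, but both sides are zero.\<close>
      have "y * ln y \<le> y * (ln q + (u - u\<^sup>2 / 2 + u ^ 3 / 3))"
      proof (cases "y = 0")
        case False
        then have "0 < 1 + u" using y q by (simp add: zero_le_mult_iff)
        then show ?thesis
          using y(2) q ln_add_one_le_cubic[of u] by (intro mult_left_mono) (auto simp: y(1) ln_mult_pos)
      qed simp
      also have "\<dots> = q * ((1 + u) * ln q + (u + u\<^sup>2 / 2 - u ^ 3 / 6 + u ^ 4 / 3))"
        unfolding y(1) by (simp add: field_simps power2_eq_square power3_eq_cube power4_eq_xxxx)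
      also have "\<dots> = q * ln q + (- q * v * (1 + ln q)) * w t
      + (q * v\<^sup>2 / 2) * w t ^ 2 + (q * v ^ 3 / 6) * w t ^ 3 + (q * v ^ 4 / 3) * w t ^ 4"
        unfolding u_def by (simp add: field_simps power2_eq_square power3_eq_cube power4_eq_xxxx)
      finally show ?thesis .
    qed
    ultimately show "real t / M * log_fall (m - 1) (t - 1)
        + (1 - real t / M) * log_fall (m - 1) t - log_fall m t
      \<le> (1 - 1 / M) * L * real t + (q * ln q + (- q * v * (1 + ln q)) * w t
      + (q * v\<^sup>2 / 2) * w t ^ 2 + (q * v ^ 3 / 6) * w t ^ 3 + (q * v ^ 4 / 3) * w t ^ 4)"
      by (simp add: y_def)
  qed
  also have "\<dots> = (1 - 1 / M) * L * (p * M) + (q * ln q + (- q * v * (1 + ln q)) * hyp_mean n k m w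
      + (q * v\<^sup>2 / 2) * hyp_mean n k m (\<lambda>t. w t ^ 2) + (q * v ^ 3 / 6) * hyp_mean n k m (\<lambda>t. w t ^ 3)
      + (q * v ^ 4 / 3) * hyp_mean n k m (\<lambda>t. w t ^ 4))"
    using hyp_mean_id[OF n(2) \<open>m \<le> n\<close>]
    by (simp only: hyp_mean_const[OF n(2) \<open>m \<le> n\<close>] hyp_mean_add hyp_mean_cmult)
      (simp add: p_def N_def M_def)
  also have "\<dots> \<le> (1 - 1 / M) * L * (p * M) + (q * ln q + (- q * v * (1 + ln q)) * 0
      + (q * v\<^sup>2 / 2) * (p * q * M * (N - M) / (N - 1)) + (q * v ^ 3 / 6) * 0
      + (q * v ^ 4 / 3) * (3 / 2 * p * q\<^sup>2 * M\<^sup>2 * N / (N - 1)))"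
  proof -
    have "(q * v ^ 3 / 6) * hyp_mean n k m (\<lambda>t. w t ^ 3) \<le> (q * v ^ 3 / 6) * 0"
      using q v by (intro mult_left_mono moments(3)) simp
    moreover have "(q * v ^ 4 / 3) * hyp_mean n k m (\<lambda>t. w t ^ 4)
        \<le> (q * v ^ 4 / 3) * (3 / 2 * p * q\<^sup>2 * M\<^sup>2 * N / (N - 1))"
      using q v by (intro mult_left_mono moments(4)) simp
    ultimately show ?thesis unfolding moments(1,2) by linarith
  qed
  also have "\<dots> = q * ln q + p * ((M - 1) * L) + p * (N - M) / (2 * M * (N - 1))
      + p * N / (2 * q * (N - 1) * M\<^sup>2)"
  proof -
    have qv: "q * v = 1 / M" using q by (simp add: v_def)
    have "(q * v\<^sup>2 / 2) * (p * q * M * (N - M) / (N - 1))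
        = (q * v)\<^sup>2 * M * (p * (N - M) / (2 * (N - 1)))"
      by (simp add: power2_eq_square)
    also have "\<dots> = p * (N - M) / (2 * M * (N - 1))"
      unfolding qv using NM by (simp add: power2_eq_square)
    finally have 1: "(q * v\<^sup>2 / 2) * (p * q * M * (N - M) / (N - 1)) = \<dots>" .
    have "(q * v ^ 4 / 3) * (3 / 2 * p * q\<^sup>2 * M\<^sup>2 * N / (N - 1))
        = (q * v) ^ 3 * M\<^sup>2 * v * (p * N / (2 * (N - 1)))"
      by (simp add: power2_eq_square power3_eq_cube power4_eq_xxxx)
    also have "\<dots> = p * N / (2 * q * (N - 1) * M\<^sup>2)"
      unfolding qv v_def using NM by (simp add: power2_eq_square power3_eq_cube)
    finally have 2: "(q * v ^ 4 / 3) * (3 / 2 * p * q\<^sup>2 * M\<^sup>2 * N / (N - 1)) = \<dots>" .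
    have "(1 - 1 / M) * L * (p * M) = p * ((M - 1) * L)"
      using NM by (simp add: algebra_simps)
    then show ?thesis unfolding 1 2 by simp
  qed
  also have "\<dots> \<le> q * ln q + p * (1 - 1 / (2 * M)) + p * (N - M) / (2 * M * (N - 1))
      + p * N / (2 * q * (N - 1) * M\<^sup>2)"
  proof -
    have "L = - ln (1 - 1 / M)"
    proof -
      have "1 - 1 / M = inverse (M / (M - 1))" using NM by (simp add: field_simps)
      then show ?thesis using NM by (simp add: L_def ln_inverse del: inverse_divide)
    qed
    then have "(M - 1) * L = M * (- ((1 - 1 / M) * ln (1 - 1 / M)))"
      using NM by (simp add: algebra_simps)
    also have "\<dots> \<le> M * (1 / M - (1 / M)\<^sup>2 / 2)"
      using entropy_lower[of "1 / M"] NM by (intro mult_left_mono) auto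
    also have "\<dots> = 1 - 1 / (2 * M)" using NM by (simp add: field_simps power2_eq_square)
    finally show ?thesis using p by (simp add: mult_left_mono)
  qed
  \<comment> \<open>The linear and second moment terms leave \<open>p / ((N - 1) * M)\<close> times
    \<open>1 / 2\<close>, the fourth moment the same factor times \<open>N / (2 * q * M)\<close>.
    Each of these is at most half of the available \<open>N / (q * (M - 1))\<close>.\<close>
  also have "\<dots> \<le> q * ln q + p - p / (2 * (N - 1)) + p * N / ((N - 1) * q * M * (M - 1))"
  proof -
    have "q * (M - 1) \<le> 1 * N" using q NM by (intro mult_mono) auto
    have "1 / 2 + N / (2 * q * M) \<le> N / (2 * q * (M - 1)) + N / (2 * q * (M - 1))"
    proof (rule add_mono)
      show "1 / 2 \<le> N / (2 * q * (M - 1))"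
        using \<open>q * (M - 1) \<le> 1 * N\<close> q NM by (simp add: field_simps)
      show "N / (2 * q * M) \<le> N / (2 * q * (M - 1))"
        using q NM by (intro divide_left_mono mult_left_mono) auto
    qed
    then have "1 / 2 + N / (2 * q * M) \<le> N / (q * (M - 1))" by simp
    then have "p / ((N - 1) * M) * (1 / 2 + N / (2 * q * M))
        \<le> p / ((N - 1) * M) * (N / (q * (M - 1)))"
      using p NM by (intro mult_left_mono) auto
    moreover have "p * (1 - 1 / (2 * M)) + p * (N - M) / (2 * M * (N - 1))
        = p - p / (2 * (N - 1)) + p / ((N - 1) * M) * (1 / 2)"
      using NM by (simp add: divide_simps) (simp add: algebra_simps)
    moreover have "p * N / (2 * q * (N - 1) * M\<^sup>2) = p / ((N - 1) * M) * (N / (2 * q * M))"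
      by (simp add: power2_eq_square)
    moreover have "p / ((N - 1) * M) * (N / (q * (M - 1))) = p * N / ((N - 1) * q * M * (M - 1))"
      by (simp add: mult_ac)
    ultimately show ?thesis unfolding distrib_left by linarith
  qed
  also have "\<dots> = (1 - real k / real n) * ln (1 - real k / real n) + real k / real n
      - real k / (2 * real n * (real n - 1))
      + real k * real n / ((real n - 1) * (real n - real k) * real m * (real m - 1))"
  proof -
    have "q = (N - real k) / N" using NM by (simp add: q_def p_def field_simps)
    then have "p * N / ((N - 1) * q * M * (M - 1)) = real k * N / ((N - 1) * (N - real k) * M * (M - 1))"
      using NM by (simp add: p_def)
    then show ?thesis by (simp add: q_def p_def N_def M_def)
  qed
  finally show ?thesis .
qed


section \<open>Summation over the recoloured balls\<close>

text \<open>Induction on \<open>l\<close> telescopes the recolouring steps, starting from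
  \<open>l = 0\<close>, where every sampled ball has the second colour and the left-hand side is
  zero.\<close>

lemma log_fall_mean_diff:
  fixes n k l :: nat
  assumes "1 \<le> k" "2 * k \<le> n" "2 * l \<le> n"
  shows "hyp_mean n k (n - l) (log_fall (n - l)) - log_fall n k
    \<le> real l * ((1 - real k / real n) * ln (1 - real k / real n) + real k / real n
        - real k / (2 * real n * (real n - 1)))
      + real k * real l / ((real n - 1) * (real n - real l) * (real n - real k))"
\<comment> \<open>The step lemma needs \<open>2 \<le> k\<close>. For \<open>k = 1\<close> every
  \<open>log_fall\<close> involved is zero, and the right-hand side has to be shown
  nonnegative.\<close>
proof (cases "k = 1")
  case True
  define N where "N = real n"
  have N: "2 \<le> N" "2 * real l \<le> N" using assms True by (auto simp: N_def)
  have 0: "log_fall m t = 0" if "t \<le> 1" "0 < m" for m t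
  proof -
    have "t = 0 \<or> t = 1" using that by linarith
    then show ?thesis using that by (elim disjE) (simp_all add: log_fall_def)
  qed
  have "hyp_mean n k (n - l) (log_fall (n - l)) = hyp_mean n k (n - l) (\<lambda>_. 0)"
    using assms True by (intro hyp_mean_cong 0) auto
  then have lhs: "hyp_mean n k (n - l) (log_fall (n - l)) - log_fall n k = 0"
    using assms True 0[of k n] by (simp add: hyp_mean_def)
  have "(1 / N)\<^sup>2 / 2 \<le> (1 - 1 / N) * ln (1 - 1 / N) + 1 / N"
  proof -
    have "0 \<le> 1 / N" "1 / N < 1" using N by simp_all
    from entropy_lower[OF this] show ?thesis by linarith
  qed
  moreover have "(1 / N)\<^sup>2 / 2 - 1 / (2 * N * (N - 1)) = - (1 / (2 * N * N * (N - 1)))"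
    using N by (simp add: divide_simps power2_eq_square)
  ultimately have "- (1 / (2 * N * N * (N - 1)))
      \<le> (1 - 1 / N) * ln (1 - 1 / N) + 1 / N - 1 / (2 * N * (N - 1))"
    by linarith
  then have "real l * - (1 / (2 * N * N * (N - 1)))
      \<le> real l * ((1 - 1 / N) * ln (1 - 1 / N) + 1 / N - 1 / (2 * N * (N - 1)))"
    by (intro mult_left_mono) auto
  \<comment> \<open>The fraction in the bound covers the deficit left by
    \<open>entropy_lower\<close>.\<close>
  moreover have "real l * (1 / (2 * N * N * (N - 1)))
      \<le> real l * (1 / ((N - 1) * (N - real l) * (N - 1)))"
  proof (intro mult_left_mono divide_left_mono)
    have "(N - real l) * (N - 1) \<le> (2 * N) * N" using N by (intro mult_mono) auto
    then have "(N - 1) * ((N - real l) * (N - 1)) \<le> (N - 1) * ((2 * N) * N)"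
      using N by (intro mult_left_mono) auto
    then show "(N - 1) * (N - real l) * (N - 1) \<le> 2 * N * N * (N - 1)" by (simp add: mult_ac)
  qed (use N in auto)
  ultimately show ?thesis unfolding lhs N_def[symmetric] using True by simp
next
  case False
  then have k: "2 \<le> k" "2 * k \<le> n" "k \<le> n" using assms by auto
  show ?thesis using assms(3)
  proof (induction l)
    case 0
    then show ?case using k by (simp add: hyp_mean_full)
  next
    case (Suc l)
    define x where "x = real n - real l"
    have x: "1 < x" "real (n - l) = x" "n - Suc l = n - l - 1"
      using Suc.prems k by (auto simp: x_def)
    define y where "y = (real n - 1) * (real n - real k)"
    \<comment> \<open>The fractions telescope:
      \<open>l / x + n / (x * (x - 1)) = (l + 1) / (x - 1)\<close>, because
      \<open>n = x + l\<close>.\<close>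
    have "real k * real l / ((real n - 1) * x * (real n - real k))
        + real k * real n / ((real n - 1) * (real n - real k) * x * (x - 1))
        = real k / y * (real l / x + real n / (x * (x - 1)))"
      by (simp add: y_def distrib_left add_divide_distrib mult_ac)
    also have "real l / x + real n / (x * (x - 1)) = (real l * (x - 1) + real n) / (x * (x - 1))"
      using x by (simp add: add_divide_distrib)
    also have "real l * (x - 1) + real n = real (Suc l) * x"
      by (simp add: x_def algebra_simps)
    also have "real (Suc l) * x / (x * (x - 1)) = real (Suc l) / (x - 1)"
      using x by simp
    also have "real k / y * (real (Suc l) / (x - 1))
        = real k * real (Suc l) / ((real n - 1) * (real n - real (Suc l)) * (real n - real k))"
      by (simp add: y_def x_def mult_ac diff_diff_eq)
    finally have fr: "real k * real l / ((real n - 1) * x * (real n - real k))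
        + real k * real n / ((real n - 1) * (real n - real k) * x * (x - 1)) = \<dots>" .
    have "hyp_mean n k (n - l - 1) (log_fall (n - l - 1)) - hyp_mean n k (n - l) (log_fall (n - l))
      \<le> ((1 - real k / real n) * ln (1 - real k / real n) + real k / real n
      - real k / (2 * real n * (real n - 1)))
      + real k * real n / ((real n - 1) * (real n - real k) * x * (x - 1))"
      using log_fall_mean_step[of k n "n - l"] Suc.prems k unfolding x(2) by simp
    moreover have "hyp_mean n k (n - l) (log_fall (n - l)) - log_fall n k
      \<le> real l * ((1 - real k / real n) * ln (1 - real k / real n) + real k / real n
        - real k / (2 * real n * (real n - 1)))
      + real k * real l / ((real n - 1) * x * (real n - real k))"
      using Suc unfolding x_def by simp
    moreover have "real (Suc l) * z = real l * z + z" for z by (simp add: distrib_right)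
    ultimately show ?case unfolding fr[symmetric] x(3) by simp
  qed
qed

section \<open>The relative entropy for two colours\<close>

lemma count_vectors_2: "count_vectors 2 k = (\<lambda>t. [t, k - t]) ` {..k}"
proof -
  have "s \<in> (\<lambda>t. [t, k - t]) ` {..k}" if "s \<in> count_vectors 2 k" for s
  proof -
    obtain a b where "s = [a, b]" "a + b = k"
      using \<open>s \<in> count_vectors 2 k\<close> by (auto simp: count_vectors_def numeral_2_eq_2 length_Suc_conv)
    then show ?thesis by (auto intro!: image_eqI[of _ _ a])
  qed
  then show ?thesis by (auto simp: count_vectors_def)
qed

text \<open>Distributing the factorials and the powers of \<open>n\<close> over the binomial
  coefficients makes the likelihood ratio a quotient of three normalised falling factorials.
  Infeasible \<open>t\<close> contribute zero on both sides.\<close>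

lemma rel_entropy_2:
  assumes "k \<le> n" "0 < l" "l < n"
  shows "rel_entropy n k [l, n - l]
    = hyp_mean n k l (\<lambda>t. log_fall l t + log_fall (n - l) (k - t) - log_fall n k)"
proof -
  define F where "F m t = real (m choose t) * fact t / real m ^ t" for m t
  have F: "log_fall m t = ln (F m t)" for m t by (simp add: log_fall_def F_def)
  have inj: "inj_on (\<lambda>t. [t, k - t]) {..k}" by (auto intro: inj_onI)
  have "mv_hypergeometric n k [l, n - l] [t, k - t]
        * ln (mv_hypergeometric n k [l, n - l] [t, k - t] / multinomial_prob n k [l, n - l] [t, k - t])
      = real (l choose t) * real ((n - l) choose (k - t))
        * (log_fall l t + log_fall (n - l) (k - t) - log_fall n k) / real (n choose k)"
    if t: "t \<le> k" for t
  proof (cases "t \<le> l \<and> k - t \<le> n - l")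
    case False
    then show ?thesis
      by (auto simp: mv_hypergeometric_def All_less_Suc2 not_le binomial_eq_0)
  next
    case True
    have cv: "[t, k - t] \<in> count_vectors 2 k" using t by (simp add: count_vectors_def)
    have H: "mv_hypergeometric n k [l, n - l] [t, k - t]
        = real (l choose t) * real ((n - l) choose (k - t)) / real (n choose k)"
      using True cv by (simp add: mv_hypergeometric_def All_less_Suc2 numeral_2_eq_2)
    have B: "multinomial_prob n k [l, n - l] [t, k - t]
        = fact k / (fact t * fact (k - t)) * ((real l / real n) ^ t * (real (n - l) / real n) ^ (k - t))"
      using cv by (simp add: multinomial_prob_def multinomial_def numeral_2_eq_2)
    have pow: "real n ^ k = real n ^ t * real n ^ (k - t)" using t by (simp flip: power_add)
    have "real (l choose t) * real ((n - l) choose (k - t)) / real (n choose k)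
        / (fact k / (fact t * fact (k - t)) * ((real l / real n) ^ t * (real (n - l) / real n) ^ (k - t)))
        = F l t * F (n - l) (k - t) / F n k"
      unfolding F_def pow power_divide using assms by (simp add: mult_ac)
    moreover have "0 < F l t" "0 < F (n - l) (k - t)" "0 < F n k"
      unfolding F_def using True assms by auto
    ultimately show ?thesis unfolding H B F by (simp add: ln_mult_pos ln_divide_pos)
  qed
  then show ?thesis
    by (simp add: rel_entropy_def count_vectors_2 sum.reindex[OF inj] hyp_mean_def sum_divide_distrib
        flip: numeral_2_eq_2)
qed

lemma of_nat_choose_2: "real (m choose 2) = real m * (real m - 1) / 2"
  by (induction m) (simp_all add: binomial_eq_0 numeral_2_eq_2 field_simps)

lemma of_nat_choose_3: "real (m choose 3) = real m * (real m - 1) * (real m - 2) / 6"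
proof (induction m)
  case (Suc m)
  have "real (Suc m choose 3) = real (m choose 2) + real (m choose 3)"
    by (simp add: numeral_2_eq_2 numeral_3_eq_3)
  then show ?case unfolding Suc of_nat_choose_2 by (simp add: field_simps)
qed (simp add: binomial_eq_0)

theorem proposition1p2:
  fixes n k l :: nat
  assumes "1 \<le> k" and "real k \<le> real n / 2"
    and "1 \<le> l" and "real l \<le> real n / 2"
  shows "rel_entropy n k [l, n - l] \<le>
      real l * ((1 - real k / real n) * ln (1 - real k / real n) + real k / real n
                - real k / (2 * real n * (real n - 1)))
      + real k * real l / ((real n - 1) * (real n - real l) * (real n - real k))
      - (if l = 1 then 0
         else real k * (real k - 1) / (2 * real n * (real n - 1))
              * (real l * (real l - 1)) * ln (real l / (real l - 1)))
      - (if l = 1 \<or> l = 2 then 0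
         else real k * (real k - 1) * (real k - 2)
                / (6 * real n * (real n - 1) * (real n - 2))
              * (real l * (real l - 1) * (real l - 2))
              * ln ((real l - 1)\<^sup>2 / (real l * (real l - 2))))"
proof -
  have kl: "2 * k \<le> n" "2 * l \<le> n" using assms(2,4) by linarith+
  then have n: "k \<le> n" "l < n" "l \<le> n" "0 < l" using assms(1,3) by auto
  define a where "a = ln (real l / (real l - 1))"
  define b where "b = ln ((real l - 1)\<^sup>2 / (real l * (real l - 2)))"
  have "hyp_mean n k l (log_fall l)
      \<le> hyp_mean n k l (\<lambda>s. - a * real (s choose 2) - b * real (s choose 3))"
    using log_fall_le[OF assms(3)] by (intro hyp_mean_mono) (simp add: a_def b_def mult.commute)
  also have "\<dots> = - a * (real (l choose 2) * real (k choose 2) / real (n choose 2))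
      - b * (real (l choose 3) * real (k choose 3) / real (n choose 3))"
    using n by (simp only: hyp_mean_diff hyp_mean_cmult hyp_mean_choose)
  also have "\<dots> = - (real k * (real k - 1) / (2 * real n * (real n - 1)) * (real l * (real l - 1)) * a)
      - real k * (real k - 1) * (real k - 2) / (6 * real n * (real n - 1) * (real n - 2))
        * (real l * (real l - 1) * (real l - 2)) * b"
    unfolding of_nat_choose_2 of_nat_choose_3 by (simp add: mult_ac) (simp add: algebra_simps)
  finally have 1: "hyp_mean n k l (log_fall l) \<le> \<dots>" .
  have "rel_entropy n k [l, n - l] = hyp_mean n k l (log_fall l)
      + (hyp_mean n k (n - l) (log_fall (n - l)) - log_fall n k)"
    using n by (simp add: rel_entropy_2 hyp_mean_diff hyp_mean_add hyp_mean_const hyp_mean_reflect)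
  also note add_mono[OF 1 log_fall_mean_diff[OF assms(1) kl]]
  \<comment> \<open>For \<open>l = 1\<close> and \<open>l = 2\<close> the stated conventions hold
    automatically, as the factors \<open>l - 1\<close> and \<open>l - 2\<close> are zero.\<close>
  finally show ?thesis unfolding a_def b_def by (cases "l = 1"; cases "l = 2") simp_all
qed

end
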